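(* The integrality gap of (LP-classic) for uniform capacitated facility location (CFL) with unit demands remains unbounded even after the addition of the submodular inequalities.
   Context: CFL with uniform capacity $U$ and unit-demand clients; (LP-classic): minimize $\sum_i f_iy_i+\sum_{i,j}c_{ij}x_{ij}$ subject to $x_{ij}\le y_i$, $\sum_i x_{ij}=1$ for all $j$, $\sum_j x_{ij}\le Uy_i$ for all $i$, $0\le y_i,x_{ij}\le1$. Submodular inequalities: for $I\subseteq F$, $J\subseteq C$, and $J_i\subseteq J$ for each $i\in I$, build a network with source $s$, an arc of capacity $\min\{U,|J_i|\}$ from $s$ to each facility node $i\in I$, unit-capacity arcs from $i$ to each client node $j\in J_i$, and unit-capacity arcs from each client node to sink $t$. Let $f(I)$ be the maximum $s$-$t$ flow value, $f(I\setminus\{i\})$ the maximum flow with arc $(s,i)$ capacity set to $0$, and $\rho_i(I\setminus\{i\})=f(I)-f(I\setminus\{i\})$. The inequality is $\sum_{i\in I}\sum_{j\in J_i}x_{ij}+\sum_{i\in I}\rho_i(I\setminus\{i\})(1-y_i)\le f(I)$. *)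

theory Defs
  imports Complex_Main "HOL-Library.Extended_Real"
begin

section \<open>Maximum flow\<close>

text \<open>A capacity function with value 0 off the arc set encodes the arcs of the network.\<close>

definition is_flow :: "'v set \<Rightarrow> ('v \<Rightarrow> 'v \<Rightarrow> real) \<Rightarrow> 'v \<Rightarrow> 'v \<Rightarrow> ('v \<Rightarrow> 'v \<Rightarrow> real) \<Rightarrow> bool" where
  "is_flow V cap s t g \<longleftrightarrow>
     (\<forall>u\<in>V. \<forall>v\<in>V. 0 \<le> g u v \<and> g u v \<le> cap u v) \<and>
     (\<forall>v\<in>V - {s, t}. (\<Sum>u\<in>V. g u v) = (\<Sum>w\<in>V. g v w))"

definition flow_value :: "'v set \<Rightarrow> 'v \<Rightarrow> ('v \<Rightarrow> 'v \<Rightarrow> real) \<Rightarrow> real" where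
  "flow_value V s g = (\<Sum>v\<in>V. g s v) - (\<Sum>v\<in>V. g v s)"

definition max_flow :: "'v set \<Rightarrow> ('v \<Rightarrow> 'v \<Rightarrow> real) \<Rightarrow> 'v \<Rightarrow> 'v \<Rightarrow> real" where
  "max_flow V cap s t = Sup {flow_value V s g |g. is_flow V cap s t g}"


section \<open>Capacitated facility location with uniform capacity and unit demands\<close>

record cfl =
  facilities :: "nat set"
  clients :: "nat set"
  capacity :: nat
  open_cost :: "nat \<Rightarrow> real"
  conn_cost :: "nat \<Rightarrow> nat \<Rightarrow> real"  \<comment> \<open>facility first, client second\<close>

text \<open>
  Connection costs are metric; for costs given only between facilities and clients this is the
  four-point form of the triangle inequality. Since the integrality gap is a supremum over
  instances, its being infinite for metric instances implies the same for arbitrary costs.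
\<close>

definition cfl_instance :: "cfl \<Rightarrow> bool" where
  "cfl_instance P \<longleftrightarrow>
     finite (facilities P) \<and> finite (clients P) \<and> 1 \<le> capacity P \<and>
     (\<forall>i\<in>facilities P. 0 \<le> open_cost P i) \<and>
     (\<forall>i\<in>facilities P. \<forall>j\<in>clients P. 0 \<le> conn_cost P i j) \<and>
     (\<forall>i\<in>facilities P. \<forall>i'\<in>facilities P. \<forall>j\<in>clients P. \<forall>j'\<in>clients P.
        conn_cost P i j \<le> conn_cost P i j' + conn_cost P i' j' + conn_cost P i' j)"

text \<open>A point is a pair \<open>(y, x)\<close> of opening and assignment variables.\<close>

type_synonym point = "(nat \<Rightarrow> real) \<times> (nat \<Rightarrow> nat \<Rightarrow> real)"

definition cost :: "cfl \<Rightarrow> point \<Rightarrow> real" where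
  "cost P = (\<lambda>(y, x).
     (\<Sum>i\<in>facilities P. open_cost P i * y i) +
     (\<Sum>i\<in>facilities P. \<Sum>j\<in>clients P. conn_cost P i j * x i j))"

definition lp_classic :: "cfl \<Rightarrow> point set" where
  "lp_classic P = {(y, x).
     (\<forall>i\<in>facilities P. \<forall>j\<in>clients P. x i j \<le> y i) \<and>
     (\<forall>j\<in>clients P. (\<Sum>i\<in>facilities P. x i j) = 1) \<and>
     (\<forall>i\<in>facilities P. (\<Sum>j\<in>clients P. x i j) \<le> real (capacity P) * y i) \<and>
     (\<forall>i\<in>facilities P. 0 \<le> y i \<and> y i \<le> 1) \<and>
     (\<forall>i\<in>facilities P. \<forall>j\<in>clients P. 0 \<le> x i j \<and> x i j \<le> 1)}"

definition cfl_solutions :: "cfl \<Rightarrow> point set" where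
  "cfl_solutions P = {(y, x) \<in> lp_classic P.
     (\<forall>i\<in>facilities P. y i \<in> {0, 1}) \<and>
     (\<forall>i\<in>facilities P. \<forall>j\<in>clients P. x i j \<in> {0, 1})}"


section \<open>Submodular inequalities\<close>

datatype node = Source | Facility nat | Client nat | Sink

definition sub_nodes :: "nat set \<Rightarrow> nat set \<Rightarrow> node set" where
  "sub_nodes I J = {Source, Sink} \<union> Facility ` I \<union> Client ` J"

text \<open>
  The set \<open>X\<close> contains the facilities whose arc from the source keeps its capacity; for all
  others that capacity is set to 0.
\<close>

fun sub_cap :: "nat \<Rightarrow> (nat \<Rightarrow> nat set) \<Rightarrow> nat set \<Rightarrow> node \<Rightarrow> node \<Rightarrow> real" where
  "sub_cap U Js X Source (Facility i) = (if i \<in> X then real (min U (card (Js i))) else 0)"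
| "sub_cap U Js X (Facility i) (Client j) = (if j \<in> Js i then 1 else 0)"
| "sub_cap U Js X (Client j) Sink = 1"
| "sub_cap U Js X _ _ = 0"

definition sub_flow :: "nat \<Rightarrow> nat set \<Rightarrow> nat set \<Rightarrow> (nat \<Rightarrow> nat set) \<Rightarrow> nat set \<Rightarrow> real" where
  "sub_flow U I J Js X = max_flow (sub_nodes I J) (sub_cap U Js X) Source Sink"

definition sub_incr :: "nat \<Rightarrow> nat set \<Rightarrow> nat set \<Rightarrow> (nat \<Rightarrow> nat set) \<Rightarrow> nat \<Rightarrow> real" where
  "sub_incr U I J Js i = sub_flow U I J Js I - sub_flow U I J Js (I - {i})"

definition submodular_ineqs :: "cfl \<Rightarrow> point set" where
  "submodular_ineqs P = {(y, x).
     \<forall>I J Js. I \<subseteq> facilities P \<longrightarrow> J \<subseteq> clients P \<longrightarrow> (\<forall>i\<in>I. Js i \<subseteq> J) \<longrightarrow>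
       (\<Sum>i\<in>I. \<Sum>j\<in>Js i. x i j) + (\<Sum>i\<in>I. sub_incr (capacity P) I J Js i * (1 - y i))
         \<le> sub_flow (capacity P) I J Js I}"


section \<open>Integrality gap\<close>

definition opt :: "cfl \<Rightarrow> point set \<Rightarrow> ereal" where
  "opt P S = (INF p\<in>S. ereal (cost P p))"

text \<open>
  The ratio is taken over feasible instances with positive relaxation optimum, so that an
  infinite gap cannot come from a division by 0 or from an infeasible instance.
\<close>

definition integrality_gap :: "(cfl \<Rightarrow> point set) \<Rightarrow> ereal" where
  "integrality_gap R =
     (SUP P\<in>{P. cfl_instance P \<and> cfl_solutions P \<noteq> {} \<and> 0 < opt P (R P)}.
        opt P (cfl_solutions P) / opt P (R P))"

end

theory Submission
  imports Defs
begin

text \<open>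
  Take three facilities of capacity \<open>U\<close>, one free and two of opening cost 1, and \<open>U + 1\<close> clients, all
  at distance 0. An integral solution must open a costly facility and pays at least 1. The
  fractional point opens the free facility completely and each costly one to the extent \<open>2 / U\<close>, and
  it assigns each client to either costly facility to the extent \<open>1 / (U + 1)\<close>. The costly
  facilities together thus serve two units of demand although one would be enough. This is why no
  submodular inequality cuts the point off: when the free facility is linked to all clients, a costly
  one has marginal value 1 only if the other costly one is linked to no client, and then the unit of
  demand served by the other is missing from the left-hand side. When the free facility is not
  linked to all clients, capacity hardly binds and the inequality essentially counts covered
  clients.
\<close>

section \<open>Maximum flow in the network of a submodular inequality\<close>

lemma sum_sub_nodes:
  fixes h :: "node \<Rightarrow> real"
  assumes "finite I" "finite J"
  shows "(\<Sum>v\<in>sub_nodes I J. h v) =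
    h Source + h Sink + (\<Sum>i\<in>I. h (Facility i)) + (\<Sum>j\<in>J. h (Client j))"
proof -
  have "(\<Sum>v\<in>sub_nodes I J. h v) =
      (\<Sum>v\<in>{Source, Sink} \<union> Facility ` I. h v) + (\<Sum>v\<in>Client ` J. h v)"
    unfolding sub_nodes_def using assms by (intro sum.union_disjoint) auto
  also have "(\<Sum>v\<in>{Source, Sink} \<union> Facility ` I. h v) =
      (\<Sum>v\<in>{Source, Sink}. h v) + (\<Sum>v\<in>Facility ` I. h v)"
    using assms by (intro sum.union_disjoint) auto
  finally show ?thesis
    by (simp add: sum.reindex inj_on_def)
qed

text \<open>Each bound is the capacity of a cut. One cuts the source arcs. The other cuts the sink
  arcs of the clients adjacent to \<open>X\<close>, since a facility outside \<open>X\<close>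
  receives nothing and so passes nothing on.\<close>

lemma sub_flow_value_le:
  assumes fin: "finite I" "finite J" and "X \<subseteq> I"
    and g: "is_flow (sub_nodes I J) (sub_cap U Js X) Source Sink g"
  shows "flow_value (sub_nodes I J) Source g \<le> real (\<Sum>i\<in>X. min U (card (Js i)))"
    and "flow_value (sub_nodes I J) Source g \<le> real (card (J \<inter> (\<Union>i\<in>X. Js i)))"
proof -
  let ?V = "sub_nodes I J"
  have bnd: "0 \<le> g u v \<and> g u v \<le> sub_cap U Js X u v" if "u \<in> ?V" "v \<in> ?V" for u v
    using g that unfolding is_flow_def by blast
  have zero: "g u v = 0" if "u \<in> ?V" "v \<in> ?V" "sub_cap U Js X u v = 0" for u v
    using bnd[OF that(1,2)] that(3) by simp
  have cons: "(\<Sum>u\<in>?V. g u v) = (\<Sum>w\<in>?V. g v w)" if "v \<in> ?V" "v \<noteq> Source" "v \<noteq> Sink" for v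
    using g that unfolding is_flow_def by blast
  have V: "Source \<in> ?V" "Sink \<in> ?V" "\<And>i. i \<in> I \<Longrightarrow> Facility i \<in> ?V" "\<And>j. j \<in> J \<Longrightarrow> Client j \<in> ?V"
    by (auto simp: sub_nodes_def)
  have val: "flow_value ?V Source g = (\<Sum>i\<in>I. g Source (Facility i))"
    unfolding flow_value_def sum_sub_nodes[OF fin] by (simp add: zero V)
  have fac: "g Source (Facility i) = (\<Sum>j\<in>J. g (Facility i) (Client j))" if "i \<in> I" for i
    using cons[OF V(3)[OF that]] that unfolding sum_sub_nodes[OF fin] by (simp add: zero V)
  have cli: "(\<Sum>i\<in>I. g (Facility i) (Client j)) \<le> 1" if "j \<in> J" for j
  proof -
    have "(\<Sum>i\<in>I. g (Facility i) (Client j)) = g (Client j) Sink"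
      using cons[OF V(4)[OF that]] that unfolding sum_sub_nodes[OF fin] by (simp add: zero V)
    then show ?thesis using bnd[OF V(4)[OF that] V(2)] by simp
  qed
  have "(\<Sum>i\<in>I. g Source (Facility i)) = (\<Sum>i\<in>X. g Source (Facility i))"
    using fin \<open>X \<subseteq> I\<close> by (intro sum.mono_neutral_right) (auto simp: zero V)
  also have "\<dots> \<le> (\<Sum>i\<in>X. real (min U (card (Js i))))"
  proof (rule sum_mono)
    fix i assume "i \<in> X"
    then show "g Source (Facility i) \<le> real (min U (card (Js i)))"
      using bnd[OF V(1) V(3)[of i]] \<open>X \<subseteq> I\<close> by auto
  qed
  finally show "flow_value ?V Source g \<le> real (\<Sum>i\<in>X. min U (card (Js i)))"
    using val by simp
  \<comment> \<open>If \<open>i\<close> is outside \<open>X\<close>, its inflow is 0; conservation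
    makes the nonnegative outflows sum to 0, so each of them vanishes.\<close>
  have out: "g (Facility i) (Client j) = 0" if "i \<in> I" "j \<in> J" "j \<notin> (\<Union>i\<in>X. Js i)" for i j
  proof (cases "i \<in> X")
    case True
    with that show ?thesis by (auto simp: zero V)
  next
    case False
    with that(1) have "(\<Sum>j\<in>J. g (Facility i) (Client j)) = 0"
      using fac[OF that(1)] by (simp add: zero V)
    then show ?thesis
      using that fin bnd[OF V(3) V(4)] by (subst (asm) sum_nonneg_eq_0_iff) auto
  qed
  have "(\<Sum>i\<in>I. g Source (Facility i)) = (\<Sum>j\<in>J. \<Sum>i\<in>I. g (Facility i) (Client j))"
    using fac by (subst sum.swap) simp
  also have "\<dots> = (\<Sum>j\<in>J \<inter> (\<Union>i\<in>X. Js i). \<Sum>i\<in>I. g (Facility i) (Client j))"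
    using fin by (intro sum.mono_neutral_right) (auto intro!: sum.neutral out)
  also have "\<dots> \<le> (\<Sum>j\<in>J \<inter> (\<Union>i\<in>X. Js i). 1)"
    by (intro sum_mono cli) auto
  finally show "flow_value ?V Source g \<le> real (card (J \<inter> (\<Union>i\<in>X. Js i)))"
    using val by simp
qed

text \<open>Every client \<open>j\<close> of \<open>B\<close> sends one unit along the path from
  \<open>Source\<close> through \<open>\<phi> j\<close> and \<open>j\<close> to \<open>Sink\<close>.
  The source arcs can carry this because a fibre of \<open>\<phi>\<close> has at most
  \<open>U\<close> elements and lies inside \<open>Js i\<close>.\<close>

lemma assignment_flow:
  assumes fin: "finite I" "finite J" and "X \<subseteq> I" "B \<subseteq> J"
    and \<phi>: "\<And>j. j \<in> B \<Longrightarrow> \<phi> j \<in> X \<and> j \<in> Js (\<phi> j)"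
    and fibre: "\<And>i. i \<in> X \<Longrightarrow> card {j \<in> B. \<phi> j = i} \<le> U"
    and JsJ: "\<And>i. i \<in> I \<Longrightarrow> Js i \<subseteq> J"
  shows "\<exists>g. is_flow (sub_nodes I J) (sub_cap U Js X) Source Sink g \<and>
    flow_value (sub_nodes I J) Source g = real (card B)"
proof -
  define g :: "node \<Rightarrow> node \<Rightarrow> real" where
    "g u v = (case (u, v) of
       (Source, Facility i) \<Rightarrow> real (card {j \<in> B. \<phi> j = i})
     | (Facility i, Client j) \<Rightarrow> (if j \<in> B \<and> \<phi> j = i then 1 else 0)
     | (Client j, Sink) \<Rightarrow> (if j \<in> B then 1 else 0)
     | _ \<Rightarrow> 0)" for u v
  have finB: "finite B" using assms finite_subset by blast
  have card_fibre: "(\<Sum>j\<in>J. if j \<in> B \<and> \<phi> j = i then 1 else 0) = real (card {j \<in> B. \<phi> j = i})" for i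
    using fin \<open>B \<subseteq> J\<close> by (simp add: sum.If_cases Int_def) (metis (mono_tags, lifting) subsetD)
  have one: "(\<Sum>i\<in>I. if j \<in> B \<and> \<phi> j = i then 1 else 0) = (if j \<in> B then 1 else 0 :: real)" for j
    using fin \<phi>[of j] \<open>X \<subseteq> I\<close> by (auto simp: sum.delta')
  have cap: "real (card {j \<in> B. \<phi> j = i}) \<le> sub_cap U Js X Source (Facility i)" if "i \<in> I" for i
  proof (cases "i \<in> X")
    case True
    have "finite (Js i)" using JsJ[OF that] fin finite_subset by blast
    then have "card {j \<in> B. \<phi> j = i} \<le> card (Js i)"
      using \<phi> by (intro card_mono) auto
    with fibre[OF True] True show ?thesis by simp
  next
    case False
    then have "card {j \<in> B. \<phi> j = i} = 0" unfolding card_eq_0_iff using \<phi> by auto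
    with False show ?thesis by simp
  qed
  have "is_flow (sub_nodes I J) (sub_cap U Js X) Source Sink g"
    unfolding is_flow_def
  proof (intro conjI ballI)
    fix u v assume "u \<in> sub_nodes I J" "v \<in> sub_nodes I J"
    then show "0 \<le> g u v" "g u v \<le> sub_cap U Js X u v"
      using cap \<phi> by (cases u; cases v; force simp: g_def sub_nodes_def)+
  next
    fix v assume v: "v \<in> sub_nodes I J - {Source, Sink}"
    then consider i where "i \<in> I" "v = Facility i" | j where "j \<in> J" "v = Client j"
      by (auto simp: sub_nodes_def)
    then show "(\<Sum>u\<in>sub_nodes I J. g u v) = (\<Sum>w\<in>sub_nodes I J. g v w)"
      by cases (simp_all add: sum_sub_nodes[OF fin] g_def card_fibre one)
  qed
  moreover have "flow_value (sub_nodes I J) Source g = real (card B)"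
  proof -
    have "flow_value (sub_nodes I J) Source g = (\<Sum>i\<in>I. \<Sum>j\<in>J. if j \<in> B \<and> \<phi> j = i then 1 else 0)"
      unfolding flow_value_def sum_sub_nodes[OF fin] by (simp add: g_def card_fibre)
    also have "\<dots> = (\<Sum>j\<in>J. if j \<in> B then 1 else 0)"
      by (subst sum.swap) (simp add: one)
    also have "\<dots> = real (card B)"
      using fin \<open>B \<subseteq> J\<close> by (simp add: sum.If_cases Int_absorb1)
    finally show ?thesis .
  qed
  ultimately show ?thesis by blast
qed

text \<open>If no \<open>Js i\<close> has more than \<open>U\<close> clients, capacity never binds
  and any choice of an adjacent facility works. Otherwise some \<open>Js a\<close> is all of
  \<open>J\<close>, with one client too many for \<open>a\<close>, and only that client has to be
  placed elsewhere.\<close>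

lemma ex_maximum_assignment:
  assumes fin: "finite J" "finite X" and card: "card J \<le> U + 1" and "1 \<le> U"
    and JsJ: "\<And>i. i \<in> X \<Longrightarrow> Js i \<subseteq> J"
  shows "\<exists>B \<phi>. B \<subseteq> J \<and> (\<forall>j\<in>B. \<phi> j \<in> X \<and> j \<in> Js (\<phi> j)) \<and>
    (\<forall>i\<in>X. card {j \<in> B. \<phi> j = i} \<le> U) \<and>
    card B = min (card (\<Union>i\<in>X. Js i)) (\<Sum>i\<in>X. min U (card (Js i)))"
proof (cases "\<forall>i\<in>X. card (Js i) \<le> U")
  case True
  define B where "B = (\<Union>i\<in>X. Js i)"
  have "\<forall>j\<in>B. \<exists>i. i \<in> X \<and> j \<in> Js i" by (auto simp: B_def)
  then obtain \<phi> where \<phi>: "\<forall>j\<in>B. \<phi> j \<in> X \<and> j \<in> Js (\<phi> j)" by metis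
  have "card {j \<in> B. \<phi> j = i} \<le> U" if "i \<in> X" for i
  proof -
    have "card {j \<in> B. \<phi> j = i} \<le> card (Js i)"
      using \<phi> JsJ[OF that] fin finite_subset by (intro card_mono) auto
    with True that show ?thesis by fastforce
  qed
  moreover have "card B \<le> (\<Sum>i\<in>X. min U (card (Js i)))"
    using card_UN_le[OF fin(2), of Js] True by (simp add: B_def min_absorb2)
  moreover have "B \<subseteq> J" using JsJ by (auto simp: B_def)
  ultimately show ?thesis
    using \<phi> by (intro exI[of _ B] exI[of _ \<phi>]) (auto simp: B_def)
next
  case False
  then obtain a where a: "a \<in> X" "card (Js a) > U" by auto
  \<comment> \<open>More than \<open>U\<close> clients inside a set of at most \<open>U + 1\<close>
    must be all of it.\<close>
  have Ja: "Js a = J" "card J = U + 1"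
    using card_mono[OF fin(1) JsJ[OF a(1)]] card_subset_eq[OF fin(1) JsJ[OF a(1)]] a card by linarith+
  have un: "(\<Union>i\<in>X. Js i) = J" using Ja a JsJ by blast
  have sum_a: "(\<Sum>i\<in>X. min U (card (Js i))) = U + (\<Sum>i\<in>X - {a}. min U (card (Js i)))"
    using a fin by (subst sum.remove[of _ a]) auto
  show ?thesis
  proof (cases "\<exists>k\<in>X - {a}. Js k \<noteq> {}")
    case True
    then obtain k l where k: "k \<in> X" "k \<noteq> a" "l \<in> Js k" by auto
    have lJ: "l \<in> J" using k JsJ by blast
    have "finite (Js k)" using JsJ[OF k(1)] fin finite_subset by blast
    then have "card (Js k) \<ge> 1"
      using k(3) by (metis One_nat_def Suc_leI card_gt_0_iff empty_iff)
    then have "1 \<le> min U (card (Js k))" using \<open>1 \<le> U\<close> by simp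
    also have "\<dots> \<le> (\<Sum>i\<in>X - {a}. min U (card (Js i)))"
      using k fin by (intro member_le_sum) auto
    finally have "min (card J) (\<Sum>i\<in>X. min U (card (Js i))) = card J"
      using sum_a Ja by simp
    \<comment> \<open>Client \<open>l\<close> moves to \<open>k\<close>, and the remaining
      \<open>U\<close> clients exactly fill \<open>a\<close>.\<close>
    moreover have "card {j \<in> J. (if j = l then k else a) = i} \<le> U" for i
    proof (cases "i = k")
      case True
      then have "{j \<in> J. (if j = l then k else a) = i} = {l}" using k lJ by auto
      with \<open>1 \<le> U\<close> show ?thesis by simp
    next
      case False
      then have "{j \<in> J. (if j = l then k else a) = i} \<subseteq> J - {l}" by auto
      then have "card {j \<in> J. (if j = l then k else a) = i} \<le> card (J - {l})"
        using fin by (intro card_mono) auto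
      with Ja lJ show ?thesis by simp
    qed
    ultimately show ?thesis
      using k a Ja un by (intro exI[of _ J] exI[of _ "\<lambda>j. if j = l then k else a"]) auto
  next
    case False
    then have "(\<Sum>i\<in>X. min U (card (Js i))) = U" using sum_a by simp
    \<comment> \<open>Only \<open>a\<close> can serve anyone, so any \<open>U\<close> clients attain
      the bound.\<close>
    moreover obtain B where B: "B \<subseteq> J" "card B = U"
      using Ja obtain_subset_with_card_n[of U J] by auto
    moreover have "card {j \<in> B. a = i} \<le> U" for i
      using B by (cases "a = i") auto
    ultimately show ?thesis
      using a Ja un by (intro exI[of _ B] exI[of _ "\<lambda>j. a"]) auto
  qed
qed

text \<open>In general a minimum over all subsets of \<open>X\<close> would be needed. Since \<open>J\<close> has at most one
  client more than the capacity, the two extreme cuts are enough.\<close>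

lemma sub_flow_eq:
  assumes fin: "finite I" "finite J" and "X \<subseteq> I" and "card J \<le> U + 1" "1 \<le> U"
    and JsJ: "\<And>i. i \<in> I \<Longrightarrow> Js i \<subseteq> J"
  shows "sub_flow U I J Js X =
    real (min (card (\<Union>i\<in>X. Js i)) (\<Sum>i\<in>X. min U (card (Js i))))"
proof -
  let ?m = "min (card (\<Union>i\<in>X. Js i)) (\<Sum>i\<in>X. min U (card (Js i)))"
  have finX: "finite X" using fin \<open>X \<subseteq> I\<close> finite_subset by blast
  have "J \<inter> (\<Union>i\<in>X. Js i) = (\<Union>i\<in>X. Js i)" using JsJ \<open>X \<subseteq> I\<close> by blast
  then have le: "flow_value (sub_nodes I J) Source g \<le> real ?m"
    if "is_flow (sub_nodes I J) (sub_cap U Js X) Source Sink g" for g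
    using sub_flow_value_le[OF fin \<open>X \<subseteq> I\<close> that] by (simp add: min_def)
  obtain B \<phi> where "B \<subseteq> J" "\<forall>j\<in>B. \<phi> j \<in> X \<and> j \<in> Js (\<phi> j)"
    "\<forall>i\<in>X. card {j \<in> B. \<phi> j = i} \<le> U" "card B = ?m"
    using ex_maximum_assignment[OF fin(2) finX assms(4,5), of Js] JsJ \<open>X \<subseteq> I\<close> by blast
  then obtain g where "is_flow (sub_nodes I J) (sub_cap U Js X) Source Sink g"
    "flow_value (sub_nodes I J) Source g = real ?m"
    using assignment_flow[OF fin \<open>X \<subseteq> I\<close>, of B \<phi> Js U] JsJ by auto
  then show ?thesis
    unfolding sub_flow_def max_flow_def by (intro cSup_eq_maximum) (auto simp: le intro!: exI[of _ g])
qed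

section \<open>The instance\<close>

definition gap_instance :: "nat \<Rightarrow> cfl" where
  "gap_instance U = \<lparr>facilities = {0, 1, 2}, clients = {..U}, capacity = U,
     open_cost = (\<lambda>i. if i = 0 then 0 else 1), conn_cost = (\<lambda>i j. 0)\<rparr>"

text \<open>Summed over the \<open>U + 1\<close> clients, the free facility serves
  \<open>U - 1\<close> units, and each costly one serves 1 unit with an opened capacity of
  2.\<close>

definition gap_point :: "nat \<Rightarrow> point" where
  "gap_point U =
     ((\<lambda>i. if i = 0 then 1 else 2 / real U),
      (\<lambda>i j. if i = 0 then (real U - 1) / (real U + 1) else 1 / (real U + 1)))"

lemma gap_instance_simps [simp]:
  "facilities (gap_instance U) = {0, 1, 2}" "clients (gap_instance U) = {..U}"
  "capacity (gap_instance U) = U" "open_cost (gap_instance U) i = (if i = 0 then 0 else 1)"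
  "conn_cost (gap_instance U) i j = 0"
  by (simp_all add: gap_instance_def)

lemma cost_gap_instance: "cost (gap_instance U) (y, x) = y 1 + y 2"
  by (simp add: cost_def)

section \<open>The fractional point satisfies the strengthened relaxation\<close>

lemma gap_point_in_lp_classic:
  assumes "2 \<le> U"
  shows "gap_point U \<in> lp_classic (gap_instance U)"
proof -
  have "(real U - 1) / (real U + 1) + (1 / (real U + 1) + 1 / (real U + 1)) = 1"
    by (simp add: add_divide_distrib[symmetric])
  moreover have "1 / (real U + 1) \<le> 2 / real U"
    using assms by (intro frac_le) auto
  ultimately show ?thesis
    using assms by (auto simp: gap_point_def lp_classic_def add.commute[of 1 "real U"])
qed

text \<open>This is the submodular inequality at \<open>gap_point U\<close>, with \<open>A\<close>,
  \<open>B\<close>, \<open>C\<close> the client sets of facilities 0, 1, 2 and \<open>f\<close> the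
  closed form of the maximum flow. An empty argument stands for a closed facility; facility 0 has no
  increment term because it is fully open.\<close>

lemma gap_point_inequality:
  fixes A B C :: "nat set" and U :: nat
  defines "f \<equiv> \<lambda>S T R. real (min (card (S \<union> T \<union> R))
    (min U (card S) + min U (card T) + min U (card R)))"
  assumes U: "2 \<le> U" and sub: "A \<subseteq> {..U}" "B \<subseteq> {..U}" "C \<subseteq> {..U}"
  shows "real (card A) * (real U - 1) / (real U + 1) + (real (card B) + real (card C)) / (real U + 1)
    + ((f A B C - f A {} C) + (f A B C - f A B {})) * (1 - 2 / real U) \<le> f A B C"
proof -
  define u e d where "u = real U" and "e = 1 / (u + 1)" and "d = 1 - 2 / u"
  have u: "2 \<le> u" using U by (simp add: u_def)
  have e: "0 < e" "(u + 1) * e = 1" and d: "0 \<le> d" "d \<le> 1" "u * d = u - 2"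
    using u by (auto simp: e_def d_def field_simps)
  have "e \<le> 2 / u" unfolding e_def using u by (intro frac_le) auto
  then have de: "d + e \<le> 1" by (simp add: d_def)
  have fin: "finite A" "finite B" "finite C" using sub finite_subset by blast+
  have le: "card S \<le> U + 1" if "S \<subseteq> {..U}" for S
    using card_mono[OF _ that] by simp
  have le': "card S \<le> U" if "S \<subseteq> {..U}" "S \<noteq> {..U}" for S
  proof -
    have "S \<subset> {..U}" using that by blast
    from psubset_card_mono[OF _ this] show ?thesis by simp
  qed
  have pos: "1 \<le> card S" if "S \<subseteq> {..U}" "S \<noteq> {}" for S
    using that finite_subset by (metis One_nat_def Suc_leI card_gt_0_iff finite_atMost)
  have be: "real (card S) * e \<le> 1" if "S \<subseteq> {..U}" for S
  proof -
    have "real (card S) * e \<le> (u + 1) * e"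
      using le[OF that] e by (intro mult_right_mono) (auto simp: u_def)
    with e show ?thesis by simp
  qed
  \<comment> \<open>The full set contributes \<open>U\<close> and another nonempty set at least 1,
    so the capacity sum reaches the \<open>U + 1\<close> clients of the union.\<close>
  have full: "f S T R = u + 1"
    if "{..U} \<in> {S, T, R}" "S \<subseteq> {..U}" "T \<subseteq> {..U}" "R \<subseteq> {..U}"
      "S \<noteq> {} \<and> T \<noteq> {} \<or> S \<noteq> {} \<and> R \<noteq> {} \<or> T \<noteq> {} \<and> R \<noteq> {}" for S T R
  proof -
    have "S \<union> T \<union> R = {..U}" using that by blast
    moreover have "U + 1 \<le> min U (card S) + min U (card T) + min U (card R)"
    proof -
      have "1 \<le> min U (card Q)" if "Q \<in> {S, T, R}" "Q \<noteq> {}" for Q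
        using that \<open>S \<subseteq> {..U}\<close> \<open>T \<subseteq> {..U}\<close> \<open>R \<subseteq> {..U}\<close> pos[of Q] U by auto
      moreover have "min U (card S) = U \<and> (T \<noteq> {} \<or> R \<noteq> {}) \<or> min U (card T) = U \<and> (S \<noteq> {} \<or> R \<noteq> {})
          \<or> min U (card R) = U \<and> (S \<noteq> {} \<or> T \<noteq> {})"
        using that(1,5) by auto
      ultimately have "min U (card S) = U \<and> (1 \<le> min U (card T) \<or> 1 \<le> min U (card R)) \<or>
          min U (card T) = U \<and> (1 \<le> min U (card S) \<or> 1 \<le> min U (card R)) \<or>
          min U (card R) = U \<and> (1 \<le> min U (card S) \<or> 1 \<le> min U (card T))"
        by blast
      then show ?thesis by linarith
    qed
    ultimately show ?thesis by (simp add: f_def u_def)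
  qed
  \<comment> \<open>Here capacity does not bind: either \<open>full\<close> applies, or every set
    has at most \<open>U\<close> clients and truncation at \<open>U\<close> has no effect. The
    remaining configurations, a full \<open>S\<close> or an empty \<open>S\<close> next to a full
    set, are handled by separate cases below.\<close>
  have union: "f S T R = real (card (S \<union> T \<union> R))"
    if "S \<subseteq> {..U}" "T \<subseteq> {..U}" "R \<subseteq> {..U}" "S \<noteq> {..U}"
      "S \<noteq> {} \<or> T \<noteq> {..U} \<and> R \<noteq> {..U}" for S T R
  proof (cases "T = {..U} \<or> R = {..U}")
    case True
    then have "S \<union> T \<union> R = {..U}" using that by blast
    moreover have "f S T R = u + 1"
      using True that by (intro full) auto
    ultimately show ?thesis by (simp add: u_def)
  next
    case False
    then have "min U (card S) + min U (card T) + min U (card R) = card S + card T + card R"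
      using that le' by simp
    moreover have "card (S \<union> T \<union> R) \<le> card S + card T + card R"
      by (meson add_mono card_Un_le le_refl order_trans)
    ultimately show ?thesis by (simp add: f_def)
  qed
  have single: "f {} T {} = real (min U (card T))" "f {} {} T = real (min U (card T))"
    "f T {} {} = real (min U (card T))" for T
    by (simp_all add: f_def)
  define a b c where "a = real (card A)" and "b = real (card B)" and "c = real (card C)"
  \<comment> \<open>The aim is to write the free facility's share as \<open>1 - 2 * e\<close>, so
    that all shares are expressed in \<open>e\<close>.\<close>
  have "a * u * e + a * e = a"
    using e by (metis (no_types) mult.assoc mult.right_neutral distrib_left distrib_right mult_1)
  moreover have "a * (u - 1) / (u + 1) = a * u * e - a * e"
    by (simp add: e_def diff_divide_distrib right_diff_distrib)
  ultimately have ae: "a * (u - 1) / (u + 1) = a - 2 * (a * e)" by linarith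
  have bce: "(b + c) / (u + 1) = b * e + c * e"
    by (simp add: e_def add_divide_distrib)
  have bc: "b * e \<le> 1" "c * e \<le> 1" using be sub by (auto simp: b_def c_def)
  have "a - 2 * (a * e) + (b * e + c * e) + ((f A B C - f A {} C) + (f A B C - f A B {})) * d \<le> f A B C"
  proof (cases "A = {..U}")
    case True
    then have a: "a = u + 1" "a * e = 1" using e by (auto simp: a_def u_def add.commute)
    have ABC: "f A S T = (if S = {} \<and> T = {} then u else u + 1)"
      if "S \<subseteq> {..U}" "T \<subseteq> {..U}" for S T
      using full[of A S T] that True by (auto simp: single u_def)
    \<comment> \<open>The two shares \<open>e\<close> missing on each client of \<open>A\<close>
      leave a slack of 2. A costly facility gains 1 only if the other has an empty set; then
      \<open>d\<close> takes the place of that facility's served demand.\<close>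
    show ?thesis
      using a bc d sub by (auto simp: ABC b_def c_def)
  next
    case A: False
    consider "A = {}" "B = {..U}" | "A = {}" "C = {..U}"
      | "A \<noteq> {} \<or> B \<noteq> {..U} \<and> C \<noteq> {..U}" by blast
    then show ?thesis
    proof cases
      case 1
      show ?thesis
      proof (cases "C = {}")
        case True
        then show ?thesis using 1 d bc by (simp add: single a_def b_def c_def u_def)
      next
        case False
        then have F: "f A B C = u + 1" "1 \<le> f A {} C" "f A B {} = u"
          using 1 sub full[of A B C] pos[OF sub(3)] U by (auto simp: single u_def)
        \<comment> \<open>The increments are at most \<open>u\<close> and 1. Since
          \<open>u * d = u - 2\<close>, the bound \<open>u - 1\<close> leaves exactly 2 for the
          demand served through \<open>B\<close> and \<open>C\<close>, each at most 1.\<close>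
        then have "((f A B C - f A {} C) + (f A B C - f A B {})) * d \<le> (u + 1) * d"
          using d by (intro mult_right_mono) auto
        also have "\<dots> \<le> u - 1" using d by (simp add: distrib_right)
        finally have "((f A B C - f A {} C) + (f A B C - f A B {})) * d \<le> u - 1" .
        moreover have "a - 2 * (a * e) = 0" using 1 by (simp add: a_def)
        ultimately show ?thesis using F(1) bc by linarith
      qed
    next
      \<comment> \<open>Mirror image of the previous case, with facilities 1 and 2
        exchanged.\<close>
      case 2
      show ?thesis
      proof (cases "B = {}")
        case True
        then show ?thesis using 2 d bc by (simp add: single a_def b_def c_def u_def)
      next
        case False
        then have F: "f A B C = u + 1" "1 \<le> f A B {}" "f A {} C = u"
          using 2 sub full[of A B C] pos[OF sub(2)] U by (auto simp: single u_def)
        then have "((f A B C - f A {} C) + (f A B C - f A B {})) * d \<le> (u + 1) * d"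
          using d by (intro mult_right_mono) auto
        also have "\<dots> \<le> u - 1" using d by (simp add: distrib_right)
        finally have "((f A B C - f A {} C) + (f A B C - f A B {})) * d \<le> u - 1" .
        moreover have "a - 2 * (a * e) = 0" using 2 by (simp add: a_def)
        ultimately show ?thesis using F(1) bc by linarith
      qed
    next
      case 3
      \<comment> \<open>Outside \<open>A\<close>, \<open>p\<close> and \<open>q\<close> count the
        clients seen by one costly facility only and \<open>r\<close> those seen by both, so the
        increments are \<open>p\<close> and \<open>q\<close>. A client then contributes at most
        \<open>1 - 2 * e + 2 * e\<close> inside \<open>A\<close>, \<open>d + e\<close> if counted by
        \<open>p\<close> or \<open>q\<close>, and \<open>2 * e\<close> if counted by
        \<open>r\<close>; none of these exceeds 1.\<close>
      define p q r where "p = real (card (B - A - C))" and "q = real (card (C - A - B))"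
        and "r = real (card (B \<inter> C - A))"
      have disj: "real (card W) = real (card S) + real (card T) + real (card R)"
        if "W = S \<union> T \<union> R" "S \<inter> T = {}" "(S \<union> T) \<inter> R = {}" "W \<subseteq> {..U}" for W S T R :: "nat set"
      proof -
        have "finite (S \<union> T \<union> R)" using that finite_subset by blast
        then show ?thesis using that by (simp add: card_Un_disjoint)
      qed
      have AC: "real (card (A \<union> C)) = a + q + r"
        unfolding a_def q_def r_def using sub by (intro disj) auto
      have AB: "real (card (A \<union> B)) = a + p + r"
        unfolding a_def p_def r_def using sub by (intro disj) auto
      have "real (card (A \<union> B \<union> C)) = real (card (A \<union> B)) + q + real (card ({} :: nat set))"
        unfolding q_def using sub by (intro disj) auto
      then have ABC: "real (card (A \<union> B \<union> C)) = a + p + q + r" using AB by simp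
      have F: "f A B C = a + p + q + r" "f A {} C = a + q + r" "f A B {} = a + p + r"
        using 3 A sub union[of A B C] union[of A "{}" C] union[of A B "{}"] AB AC ABC by auto
      have "b \<le> a + p + r" "c \<le> a + q + r"
        unfolding AB[symmetric] AC[symmetric] b_def c_def using fin by (auto intro!: card_mono)
      then have "b * e \<le> (a + p + r) * e" "c * e \<le> (a + q + r) * e"
        using e by (auto intro!: mult_right_mono)
      moreover have "(p + q) * (d + e) \<le> p + q"
        using de by (intro mult_left_le) (auto simp: p_def q_def)
      moreover have "r * (2 * e) \<le> r"
        using u by (intro mult_left_le) (auto simp: r_def e_def field_simps)
      ultimately show ?thesis unfolding F by (simp add: algebra_simps)
    qed
  qed
  then show ?thesis
    using ae bce unfolding a_def b_def c_def d_def u_def by linarith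
qed

text \<open>Padding with empty client sets turns every choice of \<open>I\<close> into three sets
  indexed by 0, 1, 2, to which \<open>gap_point_inequality\<close> applies.\<close>

lemma gap_point_submodular:
  assumes U: "2 \<le> U"
  shows "gap_point U \<in> submodular_ineqs (gap_instance U)"
proof -
  obtain y x where p: "gap_point U = (y, x)" by fastforce
  have y: "y i = (if i = 0 then 1 else 2 / real U)"
    and x: "x i j = (if i = 0 then (real U - 1) / (real U + 1) else 1 / (real U + 1))" for i j
    using p by (auto simp: gap_point_def)
  have "(\<Sum>i\<in>I. \<Sum>j\<in>Js i. x i j) + (\<Sum>i\<in>I. sub_incr U I J Js i * (1 - y i)) \<le> sub_flow U I J Js I"
    if I: "I \<subseteq> {0, 1, 2}" and J: "J \<subseteq> {..U}" and Js: "\<forall>i\<in>I. Js i \<subseteq> J" for I J Js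
  proof -
    define K where "K i = (if i \<in> I then Js i else {})" for i
    have fin: "finite I" "finite J" using I J finite_subset by auto
    have cardJ: "card J \<le> U + 1" using card_mono[OF _ J] by simp
    have flow: "sub_flow U I J Js X = real (min (card (K' 0 \<union> K' 1 \<union> K' 2))
        (min U (card (K' 0)) + min U (card (K' 1)) + min U (card (K' 2))))"
      if "X \<subseteq> I" and K': "\<And>i. K' i = (if i \<in> X then K i else {})" for X K'
    proof -
      have "(\<Union>i\<in>X. Js i) = (\<Union>i\<in>{0,1,2}. K' i)"
        using that I by (fastforce simp: K_def split: if_splits)
      moreover have "(\<Sum>i\<in>X. min U (card (Js i))) = (\<Sum>i\<in>{0,1,2}. min U (card (K' i)))"
        using that I by (intro sum.mono_neutral_cong_left) (auto simp: K_def)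
      ultimately show ?thesis
        using sub_flow_eq[OF fin \<open>X \<subseteq> I\<close> cardJ] U Js
        by (simp add: Un_assoc Un_commute Un_left_commute add.assoc)
    qed
    let ?f = "\<lambda>S T R. real (min (card (S \<union> T \<union> R))
      (min U (card S) + min U (card T) + min U (card R)))"
    have f: "sub_flow U I J Js I = ?f (K 0) (K 1) (K 2)"
      by (rule flow) (auto simp: K_def)
    have f1: "sub_flow U I J Js (I - {1}) = ?f (K 0) {} (K 2)"
      using flow[of "I - {1}" "K(1 := {})"] by (auto simp: K_def)
    have f2: "sub_flow U I J Js (I - {2}) = ?f (K 0) (K 1) {}"
      using flow[of "I - {2}" "K(2 := {})"] by (auto simp: K_def)
    \<comment> \<open>For \<open>i\<close> outside \<open>I\<close>, \<open>I - {i}\<close> equals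
      \<open>I\<close>, so the increment is 0; the term for facility 0 vanishes because
      \<open>y 0 = 1\<close>.\<close>
    have "(\<Sum>i\<in>I. sub_incr U I J Js i * (1 - y i)) =
        (\<Sum>i\<in>{0,1,2}. sub_incr U I J Js i * (1 - y i))"
      using I by (intro sum.mono_neutral_left) (auto simp: sub_incr_def)
    also have "\<dots> = (sub_incr U I J Js 1 + sub_incr U I J Js 2) * (1 - 2 / real U)"
      by (simp add: y distrib_right)
    finally have incr: "(\<Sum>i\<in>I. sub_incr U I J Js i * (1 - y i)) = \<dots>" .
    have "(\<Sum>i\<in>I. \<Sum>j\<in>Js i. x i j) = (\<Sum>i\<in>{0,1,2}. \<Sum>j\<in>K i. x i j)"
      using I by (rule sum.mono_neutral_cong_left[rotated]) (auto simp: K_def)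
    also have "\<dots> = real (card (K 0)) * (real U - 1) / (real U + 1)
        + (real (card (K 1)) + real (card (K 2))) / (real U + 1)"
      by (simp add: x add_divide_distrib)
    finally have served: "(\<Sum>i\<in>I. \<Sum>j\<in>Js i. x i j) = \<dots>" .
    have "K i \<subseteq> {..U}" for i using J Js by (auto simp: K_def)
    then show ?thesis
      unfolding served incr unfolding sub_incr_def f f1 f2 by (intro gap_point_inequality[OF U])
  qed
  then show ?thesis unfolding p submodular_ineqs_def by auto
qed

section \<open>Integral and fractional optima of the instance\<close>

lemma cost_cfl_solution_ge_1:
  assumes "p \<in> cfl_solutions (gap_instance U)"
  shows "1 \<le> cost (gap_instance U) p"
proof -
  obtain y x where p: "p = (y, x)" by fastforce
  have y01: "y i \<in> {0, 1}" if "i \<in> {0, 1, 2}" for i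
    using assms that by (auto simp: p cfl_solutions_def)
  have le: "0 \<le> x i j \<and> x i j \<le> y i" if "i \<in> {0, 1, 2}" "j \<le> U" for i j
    using assms that by (auto simp: p cfl_solutions_def lp_classic_def)
  have srv: "x 0 j + x 1 j + x 2 j = 1" if "j \<le> U" for j
    using assms that by (auto simp: p cfl_solutions_def lp_classic_def add.assoc)
  have cap: "(\<Sum>j\<le>U. x 0 j) \<le> real U * y 0"
    using assms by (auto simp: p cfl_solutions_def lp_classic_def)
  \<comment> \<open>Otherwise the free facility would serve all \<open>U + 1\<close> clients with
    capacity \<open>U\<close>.\<close>
  have "\<not> (y 1 = 0 \<and> y 2 = 0)"
  proof
    assume *: "y 1 = 0 \<and> y 2 = 0"
    have "x 0 j = 1" if "j \<le> U" for j
      using le[of 1 j] le[of 2 j] srv[of j] * that by simp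
    then have "real U + 1 \<le> real U * y 0" using cap by simp
    then show False using y01[of 0] by auto
  qed
  then show ?thesis
    using y01[of 1] y01[of 2] by (auto simp: p cost_gap_instance)
qed

text \<open>The free facility serves at most \<open>U\<close> of the \<open>U + 1\<close> units, so
  the costly ones need total capacity at least 1. This keeps the relaxation optimum positive, as
  \<open>integrality_gap\<close> demands.\<close>

lemma cost_lp_classic_gap_instance_ge:
  assumes "p \<in> lp_classic (gap_instance U)" "1 \<le> U"
  shows "1 / real U \<le> cost (gap_instance U) p"
proof -
  obtain y x where p: "p = (y, x)" by fastforce
  have cap: "(\<Sum>j\<le>U. x i j) \<le> real U * y i" if "i \<in> {0, 1, 2}" for i
    using assms that by (auto simp: p lp_classic_def)
  have srv: "x 0 j + x 1 j + x 2 j = 1" if "j \<le> U" for j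
    using assms that by (auto simp: p lp_classic_def add.assoc)
  have "y 0 \<le> 1" using assms by (auto simp: p lp_classic_def)
  then have "real U * y 0 \<le> real U" by (simp add: mult_left_le)
  moreover have "real U + 1 = (\<Sum>j\<le>U. x 0 j + x 1 j + x 2 j)"
    using srv by simp
  ultimately have "1 \<le> real U * (y 1 + y 2)"
    using cap[of 0] cap[of 1] cap[of 2] by (simp add: sum.distrib algebra_simps)
  with assms(2) show ?thesis by (simp add: p cost_gap_instance field_simps)
qed

lemma cfl_solutions_gap_instance_nonempty:
  assumes "1 \<le> U"
  shows "cfl_solutions (gap_instance U) \<noteq> {}"
proof -
  \<comment> \<open>With all facilities open, client 0 goes to facility 1 and the other
    \<open>U\<close> clients fill facility 0.\<close>
  let ?x = "\<lambda>(i::nat) (j::nat). if j = 0 then (if i = 1 then 1 else 0) else (if i = 0 then 1 else 0)"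
  have "(\<Sum>j\<le>U. if j = 0 then a else b) = a + real U * b" for a b :: real
    by (simp add: sum.atMost_shift)
  then have "((\<lambda>i. 1), ?x) \<in> cfl_solutions (gap_instance U)"
    using assms by (auto simp: cfl_solutions_def lp_classic_def)
  then show ?thesis by blast
qed

text \<open>Integral solutions cost at least 1, while \<open>gap_point U\<close> costs
  \<open>4 / U\<close>.\<close>

lemma integrality_gap_ge:
  assumes U: "2 \<le> U"
  shows "ereal (real U / 4) \<le> integrality_gap (\<lambda>P. lp_classic P \<inter> submodular_ineqs P)"
proof -
  let ?P = "gap_instance U"
  let ?R = "lp_classic ?P \<inter> submodular_ineqs ?P"
  have "cost ?P (gap_point U) = 4 / real U"
    by (simp add: gap_point_def cost_gap_instance)
  then have up: "opt ?P ?R \<le> ereal (4 / real U)"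
    unfolding opt_def using gap_point_in_lp_classic[OF U] gap_point_submodular[OF U]
    by (metis IntI INF_lower)
  have "0 < ereal (1 / real U)" using U by simp
  also have "\<dots> \<le> opt ?P ?R"
    unfolding opt_def using U cost_lp_classic_gap_instance_ge[of _ U] by (intro INF_greatest) auto
  finally have pos: "0 < opt ?P ?R" .
  have "1 \<le> opt ?P (cfl_solutions ?P)"
    unfolding opt_def using cost_cfl_solution_ge_1 by (intro INF_greatest) (auto simp: one_ereal_def)
  then have "1 / opt ?P ?R \<le> opt ?P (cfl_solutions ?P) / opt ?P ?R"
    using pos by (intro ereal_divide_right_mono)
  moreover have "ereal (real U / 4) \<le> 1 / opt ?P ?R"
  proof -
    \<comment> \<open>Being positive and bounded above by a real, the optimum is itself real, so the
      quotient can be computed in the reals.\<close>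
    from up pos obtain r where r: "opt ?P ?R = ereal r" by (cases "opt ?P ?R") auto
    with up pos U have "0 < r" "r \<le> 4 / real U" by auto
    with U show ?thesis by (auto simp: r one_ereal_def field_simps)
  qed
  moreover have "cfl_instance ?P" using U by (simp add: cfl_instance_def)
  ultimately show ?thesis
    unfolding integrality_gap_def using U pos cfl_solutions_gap_instance_nonempty[of U]
    by (intro SUP_upper2[of ?P]) (auto intro: order_trans)
qed

theorem theorem5:
  "integrality_gap (\<lambda>P. lp_classic P \<inter> submodular_ineqs P) = \<infinity>"
proof (rule ereal_top)
  fix B :: real
  obtain n :: nat where "B < real n" using reals_Archimedean2 by blast
  \<comment> \<open>The choice \<open>U = 4 * n + 2\<close> ensures \<open>2 \<le> U\<close> and
    gives a gap of at least \<open>n + 1/2\<close>.\<close>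
  then have "ereal B \<le> ereal (real (4 * n + 2) / 4)" by simp
  also have "\<dots> \<le> integrality_gap (\<lambda>P. lp_classic P \<inter> submodular_ineqs P)"
    by (rule integrality_gap_ge) simp
  finally show "ereal B \<le> integrality_gap (\<lambda>P. lp_classic P \<inter> submodular_ineqs P)" .
qed

end
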